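(* Let $n\geq 1$ and let $\mu$ be an update mode written as a finite sequence of blocks (subsets) of elements of $\llbracket n\rrbracket$. Then $\mu\in\mathsf{BS}_n\cap\varphi(\mathsf{BP}_n)$ if and only if $\mu$ is an ordered partition of $\llbracket n\rrbracket$ and all of $\mu$'s blocks are of the same size.
   Context: Notation: $\llbracket n\rrbracket=\{0,\dots,n-1\}$. A sequence $(W_\ell)_{\ell\in\llbracket p\rrbracket}$ of subsets of $\llbracket n\rrbracket$ (blocks) is an ordered partition of $\llbracket n\rrbracket$ if $\bigcup_{\ell\in\llbracket p\rrbracket}W_\ell=\llbracket n\rrbracket$ and $W_i\cap W_j=\emptyset$ for all $i\neq j$. $\mathsf{BS}_n$ is the set of block-sequential update modes of size $n$, i.e. of ordered partitions of $\llbracket n\rrbracket$. A partitioned order of $\llbracket n\rrbracket$ is an (unordered) set $\{S_k\}_{k\in\llbracket s\rrbracket}$ of $s$ sequences $S_k=(i^k_0,\dots,i^k_{n_k-1})$ with $n_k>0$, each consisting of pairwise distinct elements of $\llbracket n\rrbracket$, the sequences being pairwise disjoint (as sets of entries) with union $\llbracket n\rrbracket$. $\mathsf{BP}_n$ is the set of all partitioned orders of $\llbracket n\rrbracket$ (block-parallel update modes of size $n$). For $\mu=\{S_k\}_{k\in\llbracket s\rrbracket}\in\mathsf{BP}_n$, let $p=\mathrm{lcm}(n_0,\dots,n_{s-1})$ and $\varphi(\mu)=(W_\ell)_{\ell\in\llbracket p\rrbracket}$ with $W_\ell=\{i^k_{\ell \bmod n_k}\mid k\in\llbracket s\rrbracket\}$.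 $\varphi(\mathsf{BP}_n)$ is the image of $\mathsf{BP}_n$ under $\varphi$, a set of sequences of blocks. *)

theory Defs
  imports Main "HOL-Library.Disjoint_Sets"
begin

text \<open>
  The ground set is \<open>{..<n}\<close>. A sequence of blocks is a list of sets. Individual blocks of an
  ordered partition are not required to be nonempty.
\<close>

definition ordered_partition :: "nat \<Rightarrow> nat set list \<Rightarrow> bool" where
  "ordered_partition n W \<longleftrightarrow>
     (\<Union>l<length W. W ! l) = {..<n} \<and>
     disjoint_family_on (\<lambda>l. W ! l) {..<length W}"

definition BS :: "nat \<Rightarrow> nat set list set" where
  "BS n = {W. ordered_partition n W}"

text \<open>
  A partitioned order is a set of lists. Since its members are nonempty and pairwise disjoint,
  an indexed family of such sequences has no repetitions, so no multiplicities are lost.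
\<close>

definition partitioned_order :: "nat \<Rightarrow> nat list set \<Rightarrow> bool" where
  "partitioned_order n P \<longleftrightarrow>
     finite P \<and>
     (\<forall>S\<in>P. 0 < length S \<and> distinct S) \<and>
     pairwise (\<lambda>S T. disjnt (set S) (set T)) P \<and>
     (\<Union>S\<in>P. set S) = {..<n}"

definition BP :: "nat \<Rightarrow> nat list set set" where
  "BP n = {P. partitioned_order n P}"

definition phi :: "nat list set \<Rightarrow> nat set list" where
  "phi P = map (\<lambda>l. {S ! (l mod length S) | S. S \<in> P}) [0..<Lcm (length ` P)]"

end

theory Submission
  imports Defs
begin

text \<open>
  If \<open>\<phi>(\<mu>)\<close> has pairwise disjoint blocks, every sequence of \<open>\<mu>\<close> must have full length \<open>p\<close>, since
  the first entry of a shorter sequence \<open>S\<close> recurs in the block with index \<open>length S\<close>. So each block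
  takes exactly one entry from each sequence. Conversely, if all blocks have size \<open>k\<close>, enumerate
  each of them and let the \<open>j\<close>-th sequence run through the \<open>j\<close>-th elements of the successive blocks.
\<close>

lemma ordered_partition_index_unique:
  assumes "ordered_partition n W" "i < length W" "j < length W" "x \<in> W ! i" "x \<in> W ! j"
  shows "i = j"
  using assms by (auto simp: ordered_partition_def disjoint_family_on_def)

lemma length_phi: "length (phi P) = Lcm (length ` P)"
  by (simp add: phi_def)

lemma nth_phi:
  assumes "l < length (phi P)"
  shows "phi P ! l = (\<lambda>S. S ! (l mod length S)) ` P"
  using assms by (auto simp: phi_def)

lemma length_eq_length_phi:
  assumes P: "partitioned_order n P" and W: "ordered_partition n (phi P)" and S: "S \<in> P"
  shows "length S = length (phi P)"
proof (rule ccontr)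
  assume ne: "length S \<noteq> length (phi P)"
  have pos: "0 < length S"
    using P S by (auto simp: partitioned_order_def)
  have "0 \<notin> length ` P" "finite (length ` P)"
    using P by (auto simp: partitioned_order_def)
  \<comment> \<open>The lcm of a finite set of nonzero numbers is nonzero, so block 0 exists, and a
    proper divisor of the lcm is strictly smaller and indexes a block as well.\<close>
  then have "0 < length (phi P)"
    by (metis Lcm_0_iff gr0I length_phi)
  have "length S dvd length (phi P)"
    using S by (simp add: length_phi)
  then have lt: "length S < length (phi P)"
    using ne \<open>0 < length (phi P)\<close> by (simp add: dvd_imp_le order_le_neq_trans)
  have "S ! 0 \<in> phi P ! 0" "S ! 0 \<in> phi P ! length S"
    using S by (auto simp: nth_phi[OF \<open>0 < length (phi P)\<close>] nth_phi[OF lt] intro: rev_image_eqI)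
  then have "0 = length S"
    using ordered_partition_index_unique[OF W \<open>0 < length (phi P)\<close> lt] by blast
  with pos show False by simp
qed

text \<open>Different sequences share no entry, so the entries that they contribute to a block never
  collide. The resulting count does not depend on \<open>l\<close>.\<close>

lemma card_nth_phi:
  assumes P: "partitioned_order n P" and W: "ordered_partition n (phi P)"
    and l: "l < length (phi P)"
  shows "card (phi P ! l) = card P"
proof -
  have "inj_on (\<lambda>S. S ! (l mod length S)) P"
  proof (rule inj_onI)
    fix S T assume ST: "S \<in> P" "T \<in> P" and eq: "S ! (l mod length S) = T ! (l mod length T)"
    have "S ! (l mod length S) \<in> set S" "T ! (l mod length T) \<in> set T"
      using P ST by (auto simp: partitioned_order_def)
    with eq have "\<not> disjnt (set S) (set T)"
      by (auto simp: disjnt_iff)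
    with P ST show "S = T"
      by (auto simp: partitioned_order_def pairwise_def)
  qed
  then show ?thesis
    by (simp add: nth_phi[OF l] card_image)
qed

text \<open>Increasing order is just a concrete choice of enumeration of each block. The first block
  supplies the size that all blocks are meant to share.\<close>

definition transversals :: "nat set list \<Rightarrow> nat list set" where
  "transversals W =
     (\<lambda>j. map (\<lambda>B. sorted_list_of_set B ! j) W) ` {..<card (hd W)}"

text \<open>Both conclusions concern one array \<open>e l ! j\<close>: fixing \<open>l\<close> and
  varying \<open>j\<close> yields a block of \<open>W\<close>, fixing \<open>j\<close> and varying
  \<open>l\<close> yields a list of \<open>transversals W\<close>.\<close>

lemma
  assumes W: "ordered_partition n W" and n: "n \<ge> 1"
    and eq: "\<forall>A\<in>set W. \<forall>B\<in>set W. card A = card B"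
  shows partitioned_order_transversals: "partitioned_order n (transversals W)"
    and phi_transversals: "phi (transversals W) = W"
proof -
  define k where "k = card (hd W)"
  define e where "e l = sorted_list_of_set (W ! l)" for l
  define f where "f j = map (\<lambda>B. sorted_list_of_set B ! j) W" for j
  have P: "transversals W = f ` {..<k}"
    by (simp add: transversals_def f_def k_def)
  have Un: "(\<Union>l<length W. W ! l) = {..<n}"
    using W by (simp add: ordered_partition_def)
  have nonempty: "{..<n} \<noteq> {}"
    using n by (simp add: lessThan_empty_iff)
  \<comment> \<open>This makes \<open>hd W\<close> a genuine block, so that \<open>k\<close> is the
    common block size.\<close>
  have ne: "W \<noteq> []"
    using Un nonempty by auto
  have fin: "finite (W ! l)" if "l < length W" for l
    by (rule finite_subset[of _ "{..<n}"]) (use Un that in auto)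
  have len_e: "length (e l) = k" if "l < length W" for l
    using eq ne that by (simp add: e_def k_def)
  have set_e: "set (e l) = W ! l" if "l < length W" for l
    using fin that by (simp add: e_def)
  have dist_e: "distinct (e l)" for l
    by (simp add: e_def)
  have len_f: "length (f j) = length W" for j
    by (simp add: f_def)
  have nth_f: "f j ! l = e l ! j" if "l < length W" for j l
    using that by (simp add: f_def e_def)
  have nth_e_mem: "e l ! j \<in> W ! l" if "l < length W" "j < k" for l j
    using that nth_mem[of j "e l"] by (simp add: len_e set_e)
  have image_nth: "(\<lambda>j. e l ! j) ` {..<k} = W ! l" if "l < length W" for l
    unfolding set_e[OF that, symmetric] using len_e[OF that]
    by (auto simp: set_conv_nth)
  \<comment> \<open>Disjointness of the blocks recovers the block index, then distinctness of the
    enumeration recovers the position. Below, \<open>l = m\<close> makes each list distinct and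
    \<open>i = j\<close> makes different lists disjoint.\<close>
  have nth_e_inj: "i = j \<and> l = m"
    if "e l ! i = e m ! j" "l < length W" "m < length W" "i < k" "j < k" for i j l m
  proof -
    have "e l ! i \<in> W ! l" "e l ! i \<in> W ! m"
      using nth_e_mem[of l i] nth_e_mem[of m j] that by auto
    then have "l = m"
      by (rule ordered_partition_index_unique[OF W that(2,3)])
    then show ?thesis
      using that by (simp add: nth_eq_iff_index_eq[OF dist_e] len_e)
  qed
  have set_f: "set (f j) = (\<lambda>l. e l ! j) ` {..<length W}" for j
    by (force simp: f_def e_def set_conv_nth)
  \<comment> \<open>With \<open>k = 0\<close> there would be no lists, and the lcm of the empty set
    is 1 instead of \<open>length W\<close>.\<close>
  have k: "0 < k"
  proof (rule ccontr)
    assume "\<not> 0 < k"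
    then have "(\<Union>l<length W. W ! l) = {}"
      using image_nth by force
    with Un nonempty show False
      by simp
  qed
  show "partitioned_order n (transversals W)"
    unfolding partitioned_order_def
  proof (intro conjI)
    show "finite (transversals W)"
      by (simp add: P)
    show "\<forall>S\<in>transversals W. 0 < length S \<and> distinct S"
      using ne by (auto simp: P len_f nth_f distinct_conv_nth simp flip: length_greater_0_conv dest: nth_e_inj)
    show "pairwise (\<lambda>S T. disjnt (set S) (set T)) (transversals W)"
      by (auto simp: P pairwise_def disjnt_iff set_f dest: nth_e_inj)
    \<comment> \<open>The entries of the array are collected list by list on the left, block by
      block on the right.\<close>
    have "(\<Union>S\<in>transversals W. set S) = (\<Union>l<length W. (\<lambda>j. e l ! j) ` {..<k})"
      by (auto simp: P set_f)
    also have "\<dots> = {..<n}"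
      using image_nth Un by simp
    finally show "(\<Union>S\<in>transversals W. set S) = {..<n}" .
  qed
  show "phi (transversals W) = W"
  proof (rule nth_equalityI)
    have "length ` transversals W = {length W}"
      using k by (auto simp: P image_image len_f)
    then show len: "length (phi (transversals W)) = length W"
      by (simp add: length_phi)
    fix l assume l: "l < length (phi (transversals W))"
    \<comment> \<open>Every list has length \<open>length W\<close>, so \<open>l\<close> is its own
      residue and the \<open>l\<close>-th entries of all lists are gathered.\<close>
    with len have "phi (transversals W) ! l = (\<lambda>j. e l ! j) ` {..<k}"
      unfolding nth_phi[OF l] by (simp add: P image_image len_f nth_f)
    with image_nth l len show "phi (transversals W) ! l = W ! l"
      by simp
  qed
qed

theorem lemma1:
  fixes n :: nat and W :: "nat set list"
  assumes "n \<ge> 1"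
    and "\<forall>B\<in>set W. B \<subseteq> {..<n}"
  shows "W \<in> BS n \<inter> phi ` BP n \<longleftrightarrow>
           ordered_partition n W \<and> (\<forall>A\<in>set W. \<forall>B\<in>set W. card A = card B)"
proof
  assume "W \<in> BS n \<inter> phi ` BP n"
  then obtain P where "partitioned_order n P" "ordered_partition n W" "W = phi P"
    by (auto simp: BS_def BP_def)
  then show "ordered_partition n W \<and> (\<forall>A\<in>set W. \<forall>B\<in>set W. card A = card B)"
    using card_nth_phi by (auto simp: in_set_conv_nth)
next
  assume "ordered_partition n W \<and> (\<forall>A\<in>set W. \<forall>B\<in>set W. card A = card B)"
  then have W: "ordered_partition n W" and eq: "\<forall>A\<in>set W. \<forall>B\<in>set W. card A = card B"
    by blast+
  have "transversals W \<in> BP n"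
    using partitioned_order_transversals[OF W assms(1) eq] by (simp add: BP_def)
  then have "W \<in> phi ` BP n"
    by (rule rev_image_eqI) (rule phi_transversals[OF W assms(1) eq, symmetric])
  with W show "W \<in> BS n \<inter> phi ` BP n"
    by (simp add: BS_def)
qed

end
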